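(* Let $q$ be a power of an odd prime and $r\ge 1$ an integer. Let $A\subseteq\mathbb F_q^r$ be a progression-free set, and let $\alpha:=q^{-r}|A|$ be its density. Then there exist $g\in\mathbb F_q^r$ and a linear subspace $V<\mathbb F_q^r$ of co-dimension $1$ such that the density of $A$ on the affine subspace $g+V$ satisfies $$\frac{|A\cap(g+V)|}{|V|}\ \ge\ \frac{\alpha-q^{-r}}{1-\alpha}.$$
   Context: A subset $A$ of an abelian group is called progression-free if for any $a,b,c\in A$ with $a+c=2b$ one has $a=c$. *)

theory Defs
  imports "HOL-Analysis.Cartesian_Space" "HOL-Computational_Algebra.Primes"
begin

definition progression_free :: "'g::ab_group_add set \<Rightarrow> bool" where
  "progression_free A \<longleftrightarrow> (\<forall>a\<in>A. \<forall>b\<in>A. \<forall>c\<in>A. a + c = b + b \<longrightarrow> a = c)"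

end

theory Submission
  imports Defs
begin

text \<open>
  For \<open>u \<noteq> 0\<close> let \<open>h\<^sub>u x\<close> count the points of \<open>A\<close> on the hyperplane \<open>u \<bullet> v = x\<close>, and let
  \<open>K\<close> be the maximum of all these counts. Then
  \<open>\<Sum>x z. (h\<^sub>u x - h\<^sub>u z)\<^sup>2 * (K - h\<^sub>u ((x + z) / 2)) \<ge> 0\<close>. Expanding this and summing over all
  \<open>u \<noteq> 0\<close> leaves two quantities that double counting evaluates exactly: the number of pairs
  \<open>a, b\<close> in \<open>A\<close> with \<open>u \<bullet> a = u \<bullet> b\<close>, and the number of triples with
  \<open>u \<bullet> (a + c) = u \<bullet> (b + b)\<close>. As \<open>A\<close> is progression-free, \<open>a + c = b + b\<close> has only the trivial
  solutions, and the inequality collapses to \<open>K * (|F|\<^sup>r - |A|) \<ge> (|A| - 1) * |F|\<^sup>r\<^sup>-\<^sup>1\<close>.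
\<close>

section \<open>Linear functionals and their hyperplanes\<close>

definition dotp :: "'f::field ^ 'n \<Rightarrow> 'f ^ 'n \<Rightarrow> 'f" where
  "dotp u v = (\<Sum>i\<in>UNIV. u $ i * v $ i)"

lemma dotp_commute: "dotp u v = dotp v u"
  by (simp add: dotp_def mult.commute)

lemma dotp_add_right: "dotp u (v + w) = dotp u v + dotp u w"
  by (simp add: dotp_def sum.distrib distrib_left)

lemma dotp_diff_right: "dotp u (v - w) = dotp u v - dotp u w"
  by (simp add: dotp_def sum_subtractf right_diff_distrib)

lemma dotp_scale_right: "dotp u (c *s v) = c * dotp u v"
  by (simp add: dotp_def sum_distrib_left mult.left_commute)

lemma dotp_zero_left [simp]: "dotp 0 v = 0"
  by (simp add: dotp_def)

lemma dotp_zero_right [simp]: "dotp v 0 = 0"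
  by (simp add: dotp_def)

lemma dotp_surj:
  assumes "u \<noteq> 0"
  obtains v where "dotp u v = x"
proof -
  obtain i where i: "u $ i \<noteq> 0"
    using assms by (auto simp: vec_eq_iff)
  have "dotp u (axis i (x / u $ i)) = (\<Sum>j\<in>UNIV. if j = i then x else 0)"
    unfolding dotp_def by (rule sum.cong) (auto simp: axis_def i)
  then show thesis using that by auto
qed

lemma dotp_fibre_eq_translate:
  assumes "dotp u g = x"
  shows "{v. dotp u v = x} = (+) g ` {v. dotp u v = 0}"
proof (intro equalityI subsetI)
  fix v assume "v \<in> {v. dotp u v = x}"
  then have "v = g + (v - g)" "v - g \<in> {v. dotp u v = 0}"
    using assms by (auto simp: dotp_diff_right)
  then show "v \<in> (+) g ` {v. dotp u v = 0}" by blast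
qed (use assms in \<open>auto simp: dotp_add_right\<close>)

text \<open>Every fibre of the functional is a translate of its kernel, and the fibres over all
  field elements partition the space.\<close>

lemma card_dotp_kernel:
  fixes u :: "'f::{field,finite} ^ 'n"
  assumes "u \<noteq> 0"
  shows "CARD('f) * card {v. dotp u v = 0} = CARD('f ^ 'n)"
proof -
  have fibre: "card {v. dotp u v = x} = card {v. dotp u v = 0}" for x
  proof -
    obtain g where "dotp u g = x" using dotp_surj[OF assms] .
    then show ?thesis by (simp add: dotp_fibre_eq_translate card_image)
  qed
  have "CARD('f ^ 'n) = (\<Sum>x\<in>UNIV. card {v. dotp u v = x})"
    using card_UN_disjoint[of "UNIV :: 'f set" "\<lambda>x. {v. dotp u v = x}"]
    by (auto simp: UNION_eq)
  also have "\<dots> = (\<Sum>x\<in>(UNIV :: 'f set). card {v. dotp u v = 0})"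
    by (intro sum.cong refl fibre)
  finally show ?thesis by simp
qed

lemma subspace_dotp_kernel: "vec.subspace {v. dotp u v = 0}"
  by (auto simp: vec.subspace_def dotp_add_right dotp_scale_right)

text \<open>A vector \<open>g\<close> on which the functional takes the value 1 lies outside the
  kernel, and together with the kernel it spans everything, because subtracting
  \<open>dotp u v *s g\<close> moves any \<open>v\<close> into the kernel.\<close>

lemma dim_dotp_kernel:
  fixes u :: "'f::field ^ 'n"
  assumes "u \<noteq> 0"
  shows "vec.dim {v. dotp u v = 0} + 1 = CARD('n)"
proof -
  let ?V = "{v. dotp u v = 0}"
  obtain g where g: "dotp u g = 1" using dotp_surj[OF assms] .
  have "v \<in> vec.span (insert g ?V)" for v
  proof -
    have "v - dotp u v *s g \<in> vec.span ?V"
      by (rule vec.span_base) (simp add: dotp_diff_right dotp_scale_right g)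
    then show ?thesis
      by (auto simp only: vec.span_insert mem_Collect_eq)
  qed
  then have "vec.span (insert g ?V) = UNIV" by auto
  then have "vec.dim (insert g ?V) = CARD('n)"
    by (metis vec.dim_span vec_dim_card)
  moreover have "g \<notin> vec.span ?V"
    using g by (simp add: vec.span_eq_iff[THEN iffD2, OF subspace_dotp_kernel])
  ultimately show ?thesis by (simp add: vec.dim_insert)
qed

section \<open>Midpoints in odd order and the inequality for a single functional\<close>

text \<open>Translation by 1 permutes the field, so summing all elements before and after it shows
  that \<open>CARD('f)\<close> is 0 in the field; if 2 were 0 as well, an odd cardinality would
  equal 1 there.\<close>

lemma two_neq_zero_of_odd_card:
  assumes "odd CARD('f::{field,finite})"
  shows "(2::'f) \<noteq> 0"
proof
  assume two: "(2::'f) = 0"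
  have "(\<Sum>x\<in>UNIV. x + 1) = (\<Sum>x\<in>UNIV. x :: 'f)"
    by (rule sum.reindex_bij_witness[of _ "\<lambda>x. x - 1" "\<lambda>x. x + 1"]) auto
  then have "of_nat CARD('f) = (0::'f)" by (simp add: sum.distrib)
  moreover obtain k where "CARD('f) = 2 * k + 1" using assms oddE by blast
  ultimately show False using two by simp
qed

lemma sum_midpoint:
  fixes h :: "'f::{field,finite} \<Rightarrow> real"
  assumes "(2::'f) \<noteq> 0"
  shows "(\<Sum>z\<in>UNIV. h ((x + z) / 2)) = (\<Sum>z\<in>UNIV. h z)"
  by (rule sum.reindex_bij_witness[of _ "\<lambda>y. 2 * y - x" "\<lambda>z. (x + z) / 2"])
     (use assms in \<open>auto simp: field_simps\<close>)

text \<open>Both square terms of the expanded sum contribute the same amount: with one endpoint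
  fixed, the midpoint runs once through the field, so the weights add up to
  \<open>CARD('f) * K - n\<close>. The mixed term supplies the triple sum and
  \<open>K * n\<^sup>2\<close>, and halving gives the claim.\<close>

lemma weighted_square_sum_bound:
  fixes h :: "'f::{field,finite} \<Rightarrow> real" and K :: real
  assumes two: "(2::'f) \<noteq> 0" and le: "\<And>x. h x \<le> K"
  defines "n \<equiv> \<Sum>x\<in>UNIV. h x"
  shows "K * n\<^sup>2 \<le> (real CARD('f) * K - n) * (\<Sum>x\<in>UNIV. (h x)\<^sup>2)
           + (\<Sum>x\<in>UNIV. \<Sum>z\<in>UNIV. h x * h z * h ((x + z) / 2))"
proof -
  let ?S = "\<Sum>x\<in>UNIV. (h x)\<^sup>2"
  let ?T = "\<Sum>x\<in>UNIV. \<Sum>z\<in>UNIV. h x * h z * h ((x + z) / 2)"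
  have pairs: "(\<Sum>x\<in>UNIV. \<Sum>z\<in>UNIV. h x * h z) = n\<^sup>2"
    by (simp add: n_def power2_eq_square sum_product)
  have diag: "(\<Sum>x\<in>UNIV. \<Sum>z\<in>UNIV. (h x)\<^sup>2 * (K - h ((x + z) / 2)))
      = (real CARD('f) * K - n) * ?S"
    by (simp add: sum_distrib_left[symmetric] sum_subtractf sum_midpoint[OF two] n_def
        sum_distrib_right[symmetric])
  have diag': "(\<Sum>x\<in>UNIV. \<Sum>z\<in>UNIV. (h z)\<^sup>2 * (K - h ((x + z) / 2)))
      = (real CARD('f) * K - n) * ?S"
    by (subst sum.swap) (use diag in \<open>simp add: add.commute\<close>)
  have cross: "(\<Sum>x\<in>UNIV. \<Sum>z\<in>UNIV. 2 * (h x * h z * h ((x + z) / 2)) - 2 * K * (h x * h z))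
      = 2 * ?T - 2 * K * n\<^sup>2"
    by (simp only: pairs[symmetric] sum_subtractf sum_distrib_left[symmetric])
  have "0 \<le> (\<Sum>x\<in>UNIV. \<Sum>z\<in>UNIV. (h x - h z)\<^sup>2 * (K - h ((x + z) / 2)))"
    by (intro sum_nonneg mult_nonneg_nonneg) (use le in auto)
  also have "\<dots> = (\<Sum>x\<in>UNIV. \<Sum>z\<in>UNIV. (h x)\<^sup>2 * (K - h ((x + z) / 2))
      + (h z)\<^sup>2 * (K - h ((x + z) / 2))
      + (2 * (h x * h z * h ((x + z) / 2)) - 2 * K * (h x * h z)))"
    by (intro sum.cong refl) (simp add: power2_eq_square algebra_simps)
  also have "\<dots> = 2 * ((real CARD('f) * K - n) * ?S) + (2 * ?T - 2 * K * n\<^sup>2)"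
    by (simp only: sum.distrib diag diag' cross)
  finally show ?thesis by linarith
qed

section \<open>Double counting of pairs and triples\<close>

text \<open>Turns moments of the hyperplane counts, which are sums over field values, into sums over
  points of \<open>A\<close>.\<close>

lemma sum_card_fibre_mult:
  fixes A :: "'a set" and \<pi> :: "'a \<Rightarrow> 'b::finite" and \<phi> :: "'b \<Rightarrow> real"
  assumes "finite A"
  shows "(\<Sum>x\<in>UNIV. real (card {a \<in> A. \<pi> a = x}) * \<phi> x) = (\<Sum>a\<in>A. \<phi> (\<pi> a))"
proof -
  have "real (card {a \<in> A. \<pi> a = x}) * \<phi> x = (\<Sum>a\<in>{a \<in> A. \<pi> a = x}. \<phi> (\<pi> a))" for x
    by simp
  then show ?thesis
    using sum.group[of A UNIV \<pi> "\<lambda>a. \<phi> (\<pi> a)"] assms by simp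
qed

text \<open>By symmetry of the form, the functionals vanishing at a nonzero \<open>w\<close>
  themselves form a hyperplane.\<close>

lemma sum_dotp_eq_zero:
  fixes w :: "'f::{field,finite} ^ 'n"
  shows "(\<Sum>u\<in>UNIV. of_bool (dotp u w = 0) :: real)
    = (if w = 0 then real CARD('f ^ 'n) else real CARD('f ^ 'n) / real CARD('f))"
proof (cases "w = 0")
  case False
  have "(\<Sum>u\<in>UNIV. of_bool (dotp u w = 0) :: real) = real (card {u. dotp w u = 0})"
    by (simp add: dotp_commute[of _ w])
  moreover have "real CARD('f) * real (card {u. dotp w u = 0}) = real CARD('f ^ 'n)"
    using card_dotp_kernel[OF False] by (metis of_nat_mult)
  ultimately show ?thesis using False by (simp add: field_simps)
qed simp

text \<open>After exchanging the sums, each of the \<open>n\<close> diagonal pairs is counted by all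
  \<open>N\<close> functionals, and each other pair by \<open>N / CARD('f)\<close> of them.\<close>

lemma sum_dotp_pairs:
  fixes A :: "('f::{field,finite} ^ 'n) set"
  defines "n \<equiv> real (card A)" and "N \<equiv> real CARD('f ^ 'n)"
  shows "(\<Sum>u\<in>UNIV. \<Sum>a\<in>A. \<Sum>b\<in>A. of_bool (dotp u b = dotp u a))
    = n * N + (n\<^sup>2 - n) * (N / real CARD('f))"
proof -
  let ?L = "N / real CARD('f)"
  have "(\<Sum>u\<in>UNIV. \<Sum>a\<in>A. \<Sum>b\<in>A. of_bool (dotp u b = dotp u a))
      = (\<Sum>a\<in>A. \<Sum>b\<in>A. \<Sum>u\<in>UNIV. of_bool (dotp u (b - a) = 0) :: real)"
    by (simp only: sum.swap[of _ A UNIV] dotp_diff_right right_minus_eq)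
  also have "\<dots> = (\<Sum>a\<in>A. \<Sum>b\<in>A. ?L + (if b = a then N - ?L else 0))"
    unfolding sum_dotp_eq_zero by (intro sum.cong refl) (auto simp: N_def)
  also have "\<dots> = n * (n * ?L + (N - ?L))"
    by (simp add: sum.distrib n_def)
  also have "\<dots> = n * N + (n\<^sup>2 - n) * ?L"
    by (simp add: power2_eq_square distrib_left right_diff_distrib left_diff_distrib
        del: times_divide_eq_left times_divide_eq_right)
  finally show ?thesis .
qed

lemma progression_free_iff:
  fixes A :: "('f::field ^ 'n) set"
  assumes "(2::'f) \<noteq> 0" "progression_free A" "a \<in> A" "b \<in> A" "c \<in> A"
  shows "a + c = b + b \<longleftrightarrow> c = a \<and> b = a"
proof
  assume eq: "a + c = b + b"
  then have ac: "a = c" using assms by (auto simp: progression_free_def)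
  have "a $ i = b $ i" for i
  proof -
    have "a $ i + a $ i = b $ i + b $ i"
      using eq ac by (metis vector_add_component)
    then have "2 * a $ i = 2 * b $ i" by (simp only: mult_2)
    then show ?thesis using assms(1) by simp
  qed
  then show "c = a \<and> b = a" using ac by (simp add: vec_eq_iff)
qed auto

text \<open>Same count as for pairs: only the \<open>n\<close> constant triples satisfy
  \<open>a + c = b + b\<close>, so these are counted \<open>N\<close> times and all others
  \<open>N / CARD('f)\<close> times.\<close>

lemma sum_dotp_triples:
  fixes A :: "('f::{field,finite} ^ 'n) set"
  assumes two: "(2::'f) \<noteq> 0" and pf: "progression_free A"
  defines "n \<equiv> real (card A)" and "N \<equiv> real CARD('f ^ 'n)"
  shows "(\<Sum>u\<in>UNIV. \<Sum>a\<in>A. \<Sum>c\<in>A. \<Sum>b\<in>A. of_bool (dotp u b = (dotp u a + dotp u c) / 2))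
    = n * N + (n ^ 3 - n) * (N / real CARD('f))"
proof -
  let ?L = "N / real CARD('f)"
  have mid: "dotp u b = (dotp u a + dotp u c) / 2 \<longleftrightarrow> dotp u (a + c - (b + b)) = 0"
    for u a b c :: "'f ^ 'n"
    unfolding dotp_diff_right dotp_add_right using two by (auto simp: field_simps)
  have trivial: "(if a + c = b + b then N else ?L)
      = ?L + (if b = a then if c = a then N - ?L else 0 else 0)"
    if "a \<in> A" "c \<in> A" "b \<in> A" for a b c
    using progression_free_iff[OF two pf that(1,3,2)] by (cases "a + c = b + b") auto
  have "(\<Sum>u\<in>UNIV. \<Sum>a\<in>A. \<Sum>c\<in>A. \<Sum>b\<in>A. of_bool (dotp u b = (dotp u a + dotp u c) / 2))
      = (\<Sum>a\<in>A. \<Sum>c\<in>A. \<Sum>b\<in>A. \<Sum>u\<in>UNIV. of_bool (dotp u (a + c - (b + b)) = 0) :: real)"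
    by (simp only: sum.swap[of _ A UNIV] mid)
  also have "\<dots> = (\<Sum>a\<in>A. \<Sum>c\<in>A. \<Sum>b\<in>A. ?L + (if b = a then if c = a then N - ?L else 0 else 0))"
    unfolding sum_dotp_eq_zero right_minus_eq N_def[symmetric]
    by (intro sum.cong refl trivial)
  also have "\<dots> = n * (n * (n * ?L) + (N - ?L))"
    by (simp add: sum.distrib n_def)
  also have "\<dots> = n * N + (n ^ 3 - n) * ?L"
    by (simp add: power3_eq_cube distrib_left right_diff_distrib left_diff_distrib
        del: times_divide_eq_left times_divide_eq_right)
  finally show ?thesis .
qed

section \<open>From the averaged inequality to a dense hyperplane\<close>

lemma hyperplane_count_bound:
  fixes A :: "('f::{field,finite} ^ 'n) set" and K :: real
  assumes two: "(2::'f) \<noteq> 0" and pf: "progression_free A"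
    and le: "\<And>u x. u \<noteq> 0 \<Longrightarrow> real (card {a \<in> A. dotp u a = x}) \<le> K"
    and A: "A \<noteq> {}"
  defines "n \<equiv> real (card A)" and "N \<equiv> real CARD('f ^ 'n)" and "Q \<equiv> real CARD('f)"
    and "L \<equiv> real CARD('f ^ 'n) / real CARD('f)"
  shows "(n - 1) * L \<le> K * (N - n)"
proof -
  define S where "S u = (\<Sum>a\<in>A. \<Sum>b\<in>A. of_bool (dotp u b = dotp u a) :: real)" for u
  define T where "T u =
    (\<Sum>a\<in>A. \<Sum>c\<in>A. \<Sum>b\<in>A. of_bool (dotp u b = (dotp u a + dotp u c) / 2) :: real)" for u
  have n: "n > 0" using A by (simp add: n_def card_gt_0_iff)
  have Q: "Q > 1"
  proof -
    have "card {0, 1::'f} \<le> CARD('f)" by (intro card_mono) auto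
    then show ?thesis by (simp add: Q_def)
  qed
  have N: "N = Q * L" using Q by (simp add: L_def N_def Q_def)
  have main: "K * n\<^sup>2 \<le> (Q * K - n) * S u + T u" if u: "u \<noteq> 0" for u
  proof -
    define h where "h x = real (card {a \<in> A. dotp u a = x})" for x
    have h_sum: "(\<Sum>x\<in>UNIV. h x * \<phi> x) = (\<Sum>a\<in>A. \<phi> (dotp u a))" for \<phi>
      unfolding h_def by (rule sum_card_fibre_mult) simp
    have h_ind: "h x = (\<Sum>b\<in>A. of_bool (dotp u b = x))" for x
      by (simp add: h_def Int_def)
    have "(\<Sum>x\<in>UNIV. h x) = n"
      using h_sum[of "\<lambda>_. 1"] by (simp add: n_def)
    moreover have "(\<Sum>x\<in>UNIV. (h x)\<^sup>2) = S u"
      unfolding S_def using h_sum[of h] by (simp only: power2_eq_square h_ind)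
    moreover have "(\<Sum>x\<in>UNIV. \<Sum>z\<in>UNIV. h x * h z * h ((x + z) / 2)) = T u"
    \<comment> \<open>The fibre identity is used twice, first for the inner sum over
      \<open>z\<close> and then for the outer sum over \<open>x\<close>.\<close>
    proof -
      have "(\<Sum>x\<in>UNIV. \<Sum>z\<in>UNIV. h x * h z * h ((x + z) / 2))
          = (\<Sum>x\<in>UNIV. h x * (\<Sum>z\<in>UNIV. h z * h ((x + z) / 2)))"
        by (simp add: sum_distrib_left mult.assoc)
      also have "\<dots> = (\<Sum>a\<in>A. \<Sum>c\<in>A. h ((dotp u a + dotp u c) / 2))"
        by (simp only: h_sum)
      finally show ?thesis by (simp only: h_ind T_def)
    qed
    moreover have "h x \<le> K" for x using le[OF u] by (simp add: h_def)
    ultimately show ?thesis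
      using weighted_square_sum_bound[OF two, of h K] by (simp add: Q_def)
  qed
  \<comment> \<open>The zero functional cuts out no hyperplane, so \<open>K\<close> need not bound
    its fibres. It is removed from the double counts, where it contributes every pair and every
    triple.\<close>
  have S0: "S 0 = n\<^sup>2" and T0: "T 0 = n ^ 3"
    by (simp_all add: S_def T_def n_def power2_eq_square power3_eq_cube)
  have S: "(\<Sum>u\<in>UNIV - {0}. S u) = n * N + (n\<^sup>2 - n) * L - n\<^sup>2"
    using sum_dotp_pairs[of A]
    unfolding S_def[symmetric] n_def[symmetric] N_def[symmetric] L_def[folded N_def, symmetric]
    by (simp add: sum_diff1 S0)
  have T: "(\<Sum>u\<in>UNIV - {0}. T u) = n * N + (n ^ 3 - n) * L - n ^ 3"
    using sum_dotp_triples[OF two pf]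
    unfolding T_def[symmetric] n_def[symmetric] N_def[symmetric] L_def[folded N_def, symmetric]
    by (simp add: sum_diff1 T0)
  have "(\<Sum>u\<in>UNIV - {0 :: 'f ^ 'n}. K * n\<^sup>2) \<le> (\<Sum>u\<in>UNIV - {0}. (Q * K - n) * S u + T u)"
    by (rule sum_mono) (use main in auto)
  also have "\<dots> = (Q * K - n) * (\<Sum>u\<in>UNIV - {0}. S u) + (\<Sum>u\<in>UNIV - {0}. T u)"
    by (simp add: sum.distrib sum_distrib_left)
  also have "(\<Sum>u\<in>UNIV - {0 :: 'f ^ 'n}. K * n\<^sup>2) = (N - 1) * (K * n\<^sup>2)"
    by (simp add: N_def card_Diff_singleton of_nat_diff Suc_leI del: CARD_vec)
  finally have "0 \<le> (Q * K - n) * (n * N + (n\<^sup>2 - n) * L - n\<^sup>2)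
      + (n * N + (n ^ 3 - n) * L - n ^ 3) - (N - 1) * (K * n\<^sup>2)"
    unfolding S T by simp
  \<comment> \<open>Substituting \<open>N = Q * L\<close> makes all terms in \<open>n ^ 3\<close>
    cancel and exposes the common factor \<open>n * (Q - 1)\<close>, which is positive.\<close>
  also have "\<dots> = (n * (Q - 1)) * (K * (N - n) - (n - 1) * L)"
    unfolding N by (simp add: algebra_simps power2_eq_square power3_eq_cube)
  finally have "0 \<le> (n * (Q - 1)) * (K * (N - n) - (n - 1) * L)" .
  moreover have "0 < n * (Q - 1)" using n Q by simp
  ultimately show ?thesis by (simp add: zero_le_mult_iff)
qed

theorem theorem1:
  fixes A :: "('f::{field,finite} ^ 'n) set"
    and q r :: nat
    and \<alpha> :: real
  assumes "\<exists>p k. prime p \<and> odd p \<and> k \<ge> 1 \<and> q = p ^ k"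
    and "CARD('f) = q"
    and "r \<ge> 1"
    and "CARD('n) = r"
    and "progression_free A"
    and "\<alpha> = real (card A) / real q ^ r"
  shows "\<exists>(g :: 'f ^ 'n) V. vec.subspace V \<and> vec.dim V + 1 = r \<and>
    real (card (A \<inter> (+) g ` V)) / real (card V) \<ge> (\<alpha> - 1 / real q ^ r) / (1 - \<alpha>)"
proof -
  define h where "h = (\<lambda>(u, x). card {a \<in> A. dotp u a = x})"
  define P where "P = (UNIV - {0 :: 'f ^ 'n}) \<times> (UNIV :: 'f set)"
  define n where "n = real (card A)"
  define N where "N = real CARD('f ^ 'n)"
  have two: "(2::'f) \<noteq> 0"
    using assms(1,2) by (intro two_neq_zero_of_odd_card) auto
  \<comment> \<open>The index type is inhabited, so a nonzero functional exists and the maximum is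
    taken over a nonempty set.\<close>
  have "axis undefined 1 \<noteq> (0 :: 'f ^ 'n)" by (simp add: axis_eq_0_iff)
  then have "P \<noteq> {}" unfolding P_def by blast
  then have "Max (h ` P) \<in> h ` P" by (intro Max_in) auto
  then obtain u x where ux: "(u, x) \<in> P" "h (u, x) = Max (h ` P)" by force
  then have u: "u \<noteq> 0" by (simp add: P_def)
  define V where "V = {v. dotp u v = 0}"
  obtain g where g: "dotp u g = x" using dotp_surj[OF u] .
  define K where "K = real (card (A \<inter> (+) g ` V))"
  have "A \<inter> (+) g ` V = {a \<in> A. dotp u a = x}"
    using dotp_fibre_eq_translate[OF g] by (auto simp: V_def)
  then have K: "K = h (u, x)" by (simp add: K_def h_def)
  have le: "real (card {a \<in> A. dotp u' a = x'}) \<le> K" if "u' \<noteq> 0" for u' x'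
  proof -
    have "h (u', x') \<le> Max (h ` P)"
      using that by (intro Max_ge) (auto simp: P_def)
    then show ?thesis unfolding K ux(2) by (simp add: h_def)
  qed
  have NL: "real q * real (card V) = N"
    using card_dotp_kernel[OF u] assms(2) unfolding N_def V_def by (metis of_nat_mult)
  have Nq: "N = real q ^ r" using assms(2,4) by (simp add: N_def)
  have "N > 0" by (simp add: N_def)
  then have pos: "real q > 0" "real (card V) > 0" using NL by (auto simp: zero_less_mult_iff)
  have nN: "n \<le> N" unfolding n_def N_def by (intro of_nat_mono card_mono) auto
  have "(\<alpha> - 1 / real q ^ r) / (1 - \<alpha>) = (n - 1) / (N - n)"
    using \<open>N > 0\<close> assms(6) by (simp add: n_def[symmetric] Nq[symmetric] field_simps)
  also have "\<dots> \<le> K / real (card V)"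
  \<comment> \<open>For empty \<open>A\<close> the left side is negative. For \<open>n = N\<close>
    its denominator is 0, so the quotient is 0 by the convention for division. Either way a
    nonnegative right side suffices.\<close>
  proof (cases "A = {} \<or> n = N")
    case True
    then show ?thesis using nN by (auto simp: n_def K_def)
  next
    case False
    then have "(n - 1) * (N / real q) \<le> K * (N - n)"
      using hyperplane_count_bound[OF two assms(5) le] assms(2)
      by (simp add: n_def N_def)
    moreover have "N / real q = real (card V)" using NL pos by (simp add: field_simps)
    ultimately show ?thesis using False nN pos by (simp add: field_simps)
  qed
  finally have "(\<alpha> - 1 / real q ^ r) / (1 - \<alpha>) \<le> K / real (card V)" .
  moreover have "vec.subspace V" "vec.dim V + 1 = r"
    using subspace_dotp_kernel dim_dotp_kernel[OF u] assms(4) by (auto simp: V_def)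
  ultimately show ?thesis unfolding K_def by blast
qed

end
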